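(* Let $d$ be a metric on a nontrivial real vector space $X$, let $f(x):=d(x,0_X)$ for $x\in X$, and let $\sigma\in[1,\infty)$. The following assertions hold: (i) $C_{\mathrm{NJ}}^{(\sigma)}(d)\ge 2^{2-\sigma}$; (ii) if $f$ is $2$-homogeneous, then $C_{\mathrm{NJ}}^{(\sigma)}(d)\ge 1$; (iii) if $f$ is subadditive and even, then $C_{\mathrm{NJ}}^{(\sigma)}(d)\le 2$.
   Context: The metric $d$ is an arbitrary metric on $X$ (not assumed translation-invariant; no continuity of the vector space operations is assumed). With $f^\sigma(x):=(f(x))^\sigma$, the von Neumann-Jordan constant of order $\sigma$ associated with $d$ is $$C_{\mathrm{NJ}}^{(\sigma)}(d):=\sup_{(x,y)\ne(0_X,0_X)}\frac{f^\sigma(x+y)+f^\sigma(x-y)}{2^{\sigma-1}(f^\sigma(x)+f^\sigma(y))}\in(0,\infty],$$ the supremum being over $(x,y)\in X\times X$. The function $f$ is $2$-homogeneous if $f(2x)=2f(x)$ for all $x\in X$; subadditive if $f(x+y)\le f(x)+f(y)$ for all $x,y\in X$; even if $f(-x)=f(x)$ for all $x\in X$. *)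

theory Defs
  imports "HOL-Analysis.Abstract_Metric_Spaces" "HOL-Library.Extended_Real"
begin

text \<open>
  The vector space is a type of class \<open>real_vector\<close>, which carries no topology or metric of its own;
  the metric is an explicit function \<open>d\<close>, required to satisfy \<open>Metric_space UNIV d\<close> and unrelated
  to the linear structure.
\<close>

definition dist_zero :: "('a::real_vector \<Rightarrow> 'a \<Rightarrow> real) \<Rightarrow> 'a \<Rightarrow> real"
  where "dist_zero d x = d x 0"

text \<open>
  The supremum may be infinite, so it is taken in \<open>ereal\<close>. For a metric \<open>d\<close> the denominator is
  positive at every \<open>(x, y) \<noteq> (0, 0)\<close>, so the real division is never a division by zero.
\<close>

definition NJ_const :: "real \<Rightarrow> ('a::real_vector \<Rightarrow> 'a \<Rightarrow> real) \<Rightarrow> ereal"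
  where "NJ_const \<sigma> d =
    (SUP (x, y) \<in> {(x, y). (x, y) \<noteq> (0, 0)}.
      ereal ((dist_zero d (x + y) powr \<sigma> + dist_zero d (x - y) powr \<sigma>) /
             (2 powr (\<sigma> - 1) * (dist_zero d x powr \<sigma> + dist_zero d y powr \<sigma>))))"

definition two_homogeneous :: "('a::real_vector \<Rightarrow> real) \<Rightarrow> bool"
  where "two_homogeneous f \<longleftrightarrow> (\<forall>x. f (2 *\<^sub>R x) = 2 * f x)"

definition subadditive_fun :: "('a::real_vector \<Rightarrow> real) \<Rightarrow> bool"
  where "subadditive_fun f \<longleftrightarrow> (\<forall>x y. f (x + y) \<le> f x + f y)"

definition even_fun :: "('a::real_vector \<Rightarrow> real) \<Rightarrow> bool"
  where "even_fun f \<longleftrightarrow> (\<forall>x. f (- x) = f x)"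

end

theory Submission
  imports Defs "HOL-Analysis.Convex"
begin

text \<open>
  The two lower bounds are the values of the quotient at \<open>(x, 0)\<close> and at \<open>(x, x)\<close> for any
  \<open>x \<noteq> 0\<close>. For the upper bound, both terms of the numerator are at most
  \<open>(f x + f y) powr \<sigma>\<close>, which by convexity is at most
  \<open>2 powr (\<sigma> - 1) * (f x powr \<sigma> + f y powr \<sigma>)\<close>.
\<close>

text \<open>Convexity of \<open>t powr p\<close> at the midpoint of \<open>a\<close> and
  \<open>b\<close>, scaled by \<open>2 powr p\<close>. It is invoked only for positive
  \<open>a\<close> and \<open>b\<close>; if one of them is 0, the factor
  \<open>2 powr (p - 1)\<close>, being at least 1, settles the claim.\<close>

lemma powr_add_le_convex:
  fixes a b p :: real
  assumes "0 \<le> a" "0 \<le> b" "1 \<le> p"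
  shows "(a + b) powr p \<le> 2 powr (p - 1) * (a powr p + b powr p)"
proof (cases "a = 0 \<or> b = 0")
  case True
  have "1 \<le> 2 powr (p - 1)"
    using assms(3) by (simp add: ge_one_powr_ge_zero)
  then have "c powr p \<le> 2 powr (p - 1) * c powr p" for c :: real
    using mult_right_mono[of 1 "2 powr (p - 1)" "c powr p"] by simp
  then show ?thesis
    using True by auto
next
  case False
  then have "((a + b) / 2) powr p \<le> (a powr p + b powr p) / 2"
    using convex_onD[OF powr_convex[OF assms(3)], of "1/2" a b] assms
    by (simp add: field_simps)
  then show ?thesis
    using assms by (simp add: powr_divide powr_diff field_simps)
qed

lemma NJ_const_ge:
  assumes "(x, y) \<noteq> (0, 0)"
  shows "ereal ((dist_zero d (x + y) powr \<sigma> + dist_zero d (x - y) powr \<sigma>) /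
      (2 powr (\<sigma> - 1) * (dist_zero d x powr \<sigma> + dist_zero d y powr \<sigma>))) \<le> NJ_const \<sigma> d"
  unfolding NJ_const_def by (rule SUP_upper2[of "(x, y)"]) (use assms in auto)

context
  fixes d :: "'a::real_vector \<Rightarrow> 'a \<Rightarrow> real"
  assumes metric: "Metric_space UNIV d"
begin

lemma dist_zero_zero: "dist_zero d 0 = 0"
  using Metric_space.zero[OF metric, of 0 0] by (simp add: dist_zero_def)

lemma dist_zero_nonneg: "0 \<le> dist_zero d x"
  using Metric_space.nonneg[OF metric] by (simp add: dist_zero_def)

lemma dist_zero_pos: "x \<noteq> 0 \<Longrightarrow> 0 < dist_zero d x"
  using Metric_space.zero[OF metric, of x 0] dist_zero_nonneg[of x]
  by (simp add: dist_zero_def order_less_le)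

lemma NJ_const_lower:
  assumes "\<exists>x::'a. x \<noteq> 0"
  shows "ereal (2 powr (2 - \<sigma>)) \<le> NJ_const \<sigma> d"
proof -
  obtain x :: 'a where x: "x \<noteq> 0"
    using assms by blast
  \<comment> \<open>At \<open>(x, 0)\<close> both \<open>x + 0\<close> and \<open>x - 0\<close> are
    \<open>x\<close>, and the origin adds \<open>0 powr \<sigma> = 0\<close> to the
    denominator.\<close>
  have "2 * dist_zero d x powr \<sigma> / (2 powr (\<sigma> - 1) * dist_zero d x powr \<sigma>) = 2 powr (2 - \<sigma>)"
    using dist_zero_pos[OF x] by (simp add: powr_diff)
  then show ?thesis
    using NJ_const_ge[of x 0 d \<sigma>] x by (simp add: dist_zero_zero)
qed

lemma NJ_const_lower_two_homogeneous:
  assumes "\<exists>x::'a. x \<noteq> 0" and "two_homogeneous (dist_zero d)"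
  shows "1 \<le> NJ_const \<sigma> d"
proof -
  obtain x :: 'a where x: "x \<noteq> 0"
    using assms(1) by blast
  have "dist_zero d (x + x) = 2 * dist_zero d x"
    using assms(2) by (simp add: two_homogeneous_def scaleR_2)
  \<comment> \<open>The difference \<open>x - x\<close> contributes 0; homogeneity turns the
    numerator into \<open>2 powr \<sigma> * dist_zero d x powr \<sigma>\<close>, which is also the
    denominator.\<close>
  then have "(dist_zero d (x + x) powr \<sigma> + dist_zero d (x - x) powr \<sigma>) /
      (2 powr (\<sigma> - 1) * (dist_zero d x powr \<sigma> + dist_zero d x powr \<sigma>)) = 1"
    using dist_zero_pos[OF x] by (simp add: dist_zero_zero powr_diff powr_mult)
  then show ?thesis
    using NJ_const_ge[of x x d \<sigma>] x by (metis one_ereal_def prod.inject)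
qed

lemma NJ_const_upper:
  assumes sub: "subadditive_fun (dist_zero d)" and even: "even_fun (dist_zero d)"
    and sigma: "1 \<le> \<sigma>"
  shows "NJ_const \<sigma> d \<le> 2"
proof -
  have "(dist_zero d (x + y) powr \<sigma> + dist_zero d (x - y) powr \<sigma>) /
      (2 powr (\<sigma> - 1) * (dist_zero d x powr \<sigma> + dist_zero d y powr \<sigma>)) \<le> 2"
    if "(x, y) \<noteq> (0, 0)" for x y
  proof -
    let ?f = "dist_zero d"
    \<comment> \<open>At least one of \<open>x\<close>, \<open>y\<close> is nonzero, so one summand
      is positive; this allows clearing the denominator at the end.\<close>
    have "0 < ?f x powr \<sigma> + ?f y powr \<sigma>"
      using that dist_zero_pos[of x] dist_zero_pos[of y]
      by (cases "x = 0") (auto intro: add_pos_nonneg add_nonneg_pos)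
    then have pos: "0 < 2 powr (\<sigma> - 1) * (?f x powr \<sigma> + ?f y powr \<sigma>)"
      by simp
    \<comment> \<open>Evenness enters only in the second bound, through
      \<open>x - y = x + (- y)\<close>.\<close>
    have "?f (x + y) \<le> ?f x + ?f y" "?f (x - y) \<le> ?f x + ?f y"
      using sub even unfolding subadditive_fun_def even_fun_def
      by (blast, metis add_uminus_conv_diff)
    then have "?f (x + y) powr \<sigma> \<le> (?f x + ?f y) powr \<sigma>"
      "?f (x - y) powr \<sigma> \<le> (?f x + ?f y) powr \<sigma>"
      using sigma by (auto intro: powr_mono2 dist_zero_nonneg)
    moreover have "(?f x + ?f y) powr \<sigma> \<le> 2 powr (\<sigma> - 1) * (?f x powr \<sigma> + ?f y powr \<sigma>)"
      using sigma by (intro powr_add_le_convex dist_zero_nonneg)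
    \<comment> \<open>The same bound holds for each of the two terms, whence the constant 2.\<close>
    ultimately have "?f (x + y) powr \<sigma> + ?f (x - y) powr \<sigma>
        \<le> 2 * (2 powr (\<sigma> - 1) * (?f x powr \<sigma> + ?f y powr \<sigma>))"
      by linarith
    then show ?thesis
      using pos by (subst pos_divide_le_eq)
  qed
  then show ?thesis
    unfolding NJ_const_def by (intro SUP_least) auto
qed

end

theorem theorem6:
  fixes d :: "'a::real_vector \<Rightarrow> 'a \<Rightarrow> real" and \<sigma> :: real
  assumes metric: "Metric_space UNIV d"
    and nontrivial: "\<exists>x::'a. x \<noteq> 0"
    and sigma: "1 \<le> \<sigma>"
  shows "NJ_const \<sigma> d \<ge> ereal (2 powr (2 - \<sigma>)) \<and>
         (two_homogeneous (dist_zero d) \<longrightarrow> NJ_const \<sigma> d \<ge> 1) \<and>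
         (subadditive_fun (dist_zero d) \<and> even_fun (dist_zero d) \<longrightarrow> NJ_const \<sigma> d \<le> 2)"
  using NJ_const_lower[OF metric nontrivial] NJ_const_lower_two_homogeneous[OF metric nontrivial]
    NJ_const_upper[OF metric _ _ sigma] by blast

end
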